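(* Let $d, g, \delta$ be positive integers and let $G$ be a finite $d$-regular graph. Assume that for every $k \leq g$ every vertex $x$ of $G$ is contained in at most $\left( \frac{d}{8\delta} \right)^k$ cycles of length $k$ in $G$, and that $h(G) \geq \frac{8d(\log(d)+2)}{\delta}$. Then $G$ admits a spanning subgraph $H$ with girth at least $g$ and $h(H) \geq \frac{\delta}{4d} h(G)$.
   Context: Graphs are undirected and simple. A spanning subgraph $H$ of $G$ is a subgraph with $V(H)=V(G)$ and $E(H)\subseteq E(G)$. For a finite graph $F$ and $S\subseteq V(F)$, $\partial_F S$ denotes the edge boundary of $S$, i.e. the set of edges of $F$ with exactly one endpoint in $S$. The Cheeger constant of $F$ is $$h(F):=\inf_{S\subset V(F),\ 0<|S|\leq |V(F)|/2} \frac{|\partial_F S|}{|S|}.$$ The girth of a graph is the length of its shortest cycle ($\infty$ if it has no cycle). $\log$ is the natural logarithm.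
   Formalization: The hypothesis δ ≤ 4d is added; without it the claim fails, e.g. for G = K_2, d = g = 1, δ = 100, where h(G) = 1 but the conclusion would require h(H) ≥ 25. *)

theory Defs
  imports Complex_Main "HOL-Library.Extended_Real"
begin

text \<open>A graph is a pair of a vertex set and a set of edges, an edge being a two-element set of
  vertices.\<close>

type_synonym 'a graph = "'a set \<times> 'a set set"

abbreviation verts :: "'a graph \<Rightarrow> 'a set" where "verts \<equiv> fst"

abbreviation edges :: "'a graph \<Rightarrow> 'a set set" where "edges \<equiv> snd"

definition simple_graph :: "'a graph \<Rightarrow> bool" where
  "simple_graph G \<longleftrightarrow> (\<forall>e\<in>edges G. e \<subseteq> verts G \<and> card e = 2)"

definition finite_graph :: "'a graph \<Rightarrow> bool" where
  "finite_graph G \<longleftrightarrow> simple_graph G \<and> finite (verts G)"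

definition regular :: "nat \<Rightarrow> 'a graph \<Rightarrow> bool" where
  "regular d G \<longleftrightarrow> (\<forall>v\<in>verts G. card {e \<in> edges G. v \<in> e} = d)"

definition spanning_subgraph :: "'a graph \<Rightarrow> 'a graph \<Rightarrow> bool" where
  "spanning_subgraph H G \<longleftrightarrow> simple_graph H \<and> verts H = verts G \<and> edges H \<subseteq> edges G"

definition edge_boundary :: "'a graph \<Rightarrow> 'a set \<Rightarrow> 'a set set" where
  "edge_boundary G S = {e \<in> edges G. card (e \<inter> S) = 1}"

text \<open>Extended reals make the infimum over the empty family (graphs with at most one vertex)
  equal to \<open>\<infinity>\<close>.\<close>

definition cheeger :: "'a graph \<Rightarrow> ereal" where
  "cheeger G = (INF S\<in>{S. S \<subseteq> verts G \<and> 0 < card S \<and> real (card S) \<le> real (card (verts G)) / 2}.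
     ereal (real (card (edge_boundary G S)) / real (card S)))"

definition cyclic_edges :: "'a list \<Rightarrow> 'a set set" where
  "cyclic_edges vs = {{vs ! i, vs ! (Suc i mod length vs)} |i. i < length vs}"

text \<open>Cycles are subgraphs, identified with their edge sets, so that a cycle is counted once and
  not once for each choice of starting vertex and direction.\<close>

definition cycles :: "'a graph \<Rightarrow> nat \<Rightarrow> 'a set set set" where
  "cycles G k =
     {C. C \<subseteq> edges G \<and> (\<exists>vs. distinct vs \<and> length vs = k \<and> 3 \<le> k \<and> C = cyclic_edges vs)}"

definition cycles_through :: "'a graph \<Rightarrow> nat \<Rightarrow> 'a \<Rightarrow> 'a set set set" where
  "cycles_through G k x = {C \<in> cycles G k. x \<in> \<Union>C}"

definition girth :: "'a graph \<Rightarrow> enat" where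
  "girth G = (INF k\<in>{k. cycles G k \<noteq> {}}. enat k)"

end

theory Submission
  imports Defs "HOL-Probability.Probability"
begin

text \<open>If \<open>d < 8\<delta>\<close>, the hypothesis on cycles leaves no cycle of length at most \<open>g\<close>, and \<open>H = G\<close> works.
  Otherwise keep each edge independently with probability \<open>p = \<delta>/d\<close> and apply the Lovasz local lemma
  to two kinds of bad events: a cycle of length less than \<open>g\<close> survives, or for some connected set \<open>T\<close>
  of at most half of the vertices fewer than \<open>p/4\<close> times the boundary edges of \<open>T\<close> survive. The lower
  bound on \<open>h(G)\<close> makes the Chernoff bound for the latter beat the number of connected sets of a given
  size through a given vertex. Connected sets suffice because the boundary of a set is the
  disjoint union of the boundaries of its components.\<close>

section \<open>The local lemma and random subsets\<close>

text \<open>Asymmetric Lovasz local lemma. By induction on the size of \<open>J\<close>, a bad event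
  has probability at most \<open>x i\<close> conditional on avoiding the events of \<open>J\<close>;
  the chain rule then multiplies the factors \<open>1 - x i\<close>. \<open>N i\<close> may contain
  \<open>i\<close>, as it does in the application, which puts one more factor \<open>1 - x i\<close>
  into the bound.\<close>

lemma (in prob_space) local_lemma:
  fixes A :: "'i \<Rightarrow> 'a set" and x :: "'i \<Rightarrow> real"
  assumes fin: "finite I"
    and ev: "\<And>i. i \<in> I \<Longrightarrow> A i \<in> events"
    and x: "\<And>i. i \<in> I \<Longrightarrow> 0 \<le> x i \<and> x i < 1"
    and N: "\<And>i. i \<in> I \<Longrightarrow> N i \<subseteq> I"
    and indep: "\<And>i J. i \<in> I \<Longrightarrow> J \<subseteq> I - N i - {i} \<Longrightarrow>
      prob (A i \<inter> (space M - (\<Union>j\<in>J. A j))) = prob (A i) * prob (space M - (\<Union>j\<in>J. A j))"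
    and bound: "\<And>i. i \<in> I \<Longrightarrow> prob (A i) \<le> x i * (\<Prod>j\<in>N i. 1 - x j)"
  shows "prob (space M - (\<Union>i\<in>I. A i)) > 0"
proof -
  define Q where "Q J = space M - (\<Union>j\<in>J. A j)" for J
  have Q_ev: "Q J \<in> events" if "J \<subseteq> I" for J
  proof -
    have "finite J" using that fin finite_subset by blast
    then show ?thesis unfolding Q_def using that ev by (intro sets.Diff sets.top sets.finite_UN) auto
  qed
  have Q_insert: "prob (Q (insert j J)) = prob (Q J) - prob (A j \<inter> Q J)" if "j \<in> I" "J \<subseteq> I" for j J
  proof -
    have "Q (insert j J) = Q J - (A j \<inter> Q J)" unfolding Q_def by auto
    then show ?thesis
      using finite_measure_Diff[of "Q J" "A j \<inter> Q J"] Q_ev[OF that(2)] ev[OF that(1)] by auto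
  qed
  \<comment> \<open>Chain rule: avoiding the events of \<open>R\<close> one after the other costs a
    factor \<open>1 - x j\<close> each. In \<open>step\<close> only proper subsets of
    \<open>K \<union> R\<close> occur, so the induction hypothesis of \<open>key\<close> can supply
    it.\<close>
  have grow: "prob (Q (K \<union> R)) \<ge> (\<Prod>j\<in>R. 1 - x j) * prob (Q K)"
    if step: "\<And>j J. j \<in> R \<Longrightarrow> K \<subseteq> J \<Longrightarrow> J \<subset> K \<union> R \<Longrightarrow> j \<notin> J \<Longrightarrow> prob (A j \<inter> Q J) \<le> x j * prob (Q J)"
      and R: "R \<subseteq> I" "K \<subseteq> I" "K \<inter> R = {}" for K R
  proof -
    have "prob (Q (K \<union> R')) \<ge> (\<Prod>j\<in>R'. 1 - x j) * prob (Q K)" if "finite R'" "R' \<subseteq> R" for R'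
      using that
    proof (induction R' rule: finite_induct)
      case empty
      then show ?case by simp
    next
      case (insert j R')
      have j: "j \<in> I" "j \<notin> K \<union> R'" using insert R by auto
      have "prob (A j \<inter> Q (K \<union> R')) \<le> x j * prob (Q (K \<union> R'))"
        using step[of j "K \<union> R'"] insert j by blast
      moreover have "prob (Q (insert j (K \<union> R'))) = prob (Q (K \<union> R')) - prob (A j \<inter> Q (K \<union> R'))"
        using insert R j by (intro Q_insert) auto
      ultimately have "prob (Q (K \<union> insert j R')) \<ge> (1 - x j) * prob (Q (K \<union> R'))"
        by (simp add: algebra_simps)
      moreover have "(1 - x j) * prob (Q (K \<union> R')) \<ge> (1 - x j) * ((\<Prod>j\<in>R'. 1 - x j) * prob (Q K))"
        using insert x[OF j(1)] by (intro mult_left_mono) auto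
      ultimately show ?case using insert by (simp add: mult.assoc)
    qed
    then show ?thesis using finite_subset[OF R(1) fin] by blast
  qed
  \<comment> \<open>The bound \<open>x i\<close> on the conditional probability given
    \<open>Q J\<close>, multiplied out so that it also makes sense for a null event
    \<open>Q J\<close>.\<close>
  have key: "prob (A i \<inter> Q J) \<le> x i * prob (Q J)" if "J \<subseteq> I" "i \<in> I" "i \<notin> J" for i J
    using that
  proof (induction "card J" arbitrary: i J rule: less_induct)
    case less
    define R K where "R = J \<inter> N i" and "K = J - N i"
    have finJ: "finite J" using finite_subset[OF less.prems(1) fin] .
    have J: "J = K \<union> R" by (auto simp: R_def K_def)
    have grown: "prob (Q (K \<union> R)) \<ge> (\<Prod>j\<in>R. 1 - x j) * prob (Q K)"
    proof (rule grow)
      fix j J' assume "j \<in> R" "K \<subseteq> J'" "J' \<subset> K \<union> R" "j \<notin> J'"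
      then show "prob (A j \<inter> Q J') \<le> x j * prob (Q J')"
        using less J psubset_card_mono[OF finJ, of J'] by (intro less.hyps) auto
    qed (use less in \<open>auto simp: R_def K_def\<close>)
    \<comment> \<open>Forgetting the neighbours in \<open>J\<close> enlarges the event, and
      \<open>A i\<close> is independent of what remains; \<open>grown\<close> recovers the loss from
      the factors over \<open>R\<close>.\<close>
    have "prob (A i \<inter> Q J) \<le> prob (A i \<inter> Q K)"
    proof (rule finite_measure_mono)
      have "K \<subseteq> I" using less.prems by (auto simp: K_def)
      then show "A i \<inter> Q K \<in> events" using Q_ev[of K] ev[OF less.prems(2)] by blast
    qed (auto simp: Q_def K_def)
    also have "\<dots> = prob (A i) * prob (Q K)"
      unfolding Q_def using less by (intro indep) (auto simp: K_def)
    also have "\<dots> \<le> (x i * (\<Prod>j\<in>N i. 1 - x j)) * prob (Q K)"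
      using bound less by (intro mult_right_mono) auto
    also have "\<dots> \<le> (x i * (\<Prod>j\<in>R. 1 - x j)) * prob (Q K)"
    proof -
      have "(\<Prod>j\<in>N i. 1 - x j) = (\<Prod>j\<in>R. 1 - x j) * (\<Prod>j\<in>N i - R. 1 - x j)"
        using prod.subset_diff[of R "N i" "\<lambda>j. 1 - x j"] finite_subset[OF N[OF less.prems(2)] fin]
        by (simp add: R_def mult.commute)
      also have "\<dots> \<le> (\<Prod>j\<in>R. 1 - x j) * 1"
        using N[OF less.prems(2)] x less.prems unfolding R_def
        by (intro mult_left_mono prod_le_1 prod_nonneg) force+
      finally show ?thesis using x[OF less.prems(2)] by (intro mult_right_mono mult_left_mono) auto
    qed
    also have "\<dots> = x i * ((\<Prod>j\<in>R. 1 - x j) * prob (Q K))" by (simp add: mult.assoc)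
    also have "\<dots> \<le> x i * prob (Q J)"
      using grown x[OF less.prems(2)] J by (intro mult_left_mono) auto
    finally show ?case .
  qed
  have "(\<Prod>j\<in>I. 1 - x j) * prob (Q {}) \<le> prob (Q ({} \<union> I))"
    using key by (intro grow) auto
  moreover have "(\<Prod>j\<in>I. 1 - x j) > 0" using x by (intro prod_pos) force
  moreover have "prob (Q {}) = 1" by (simp add: Q_def prob_space)
  ultimately show ?thesis by (simp add: Q_def)
qed

lemma exp_minus_two_le:
  fixes x :: real
  assumes "0 \<le> x" "x \<le> 1 / 2"
  shows "exp (- 2 * x) \<le> 1 - x"
proof -
  have "1 + 2 * x \<le> exp (2 * x)" by (rule exp_ge_add_one_self)
  moreover have "1 \<le> (1 - x) * (1 + 2 * x)"
    using mult_nonneg_nonneg[of x "1 - 2 * x"] assms by (simp add: algebra_simps)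
  ultimately have "1 \<le> (1 - x) * exp (2 * x)"
    using mult_left_mono[of "1 + 2 * x" "exp (2 * x)" "1 - x"] assms by linarith
  then show ?thesis by (simp add: exp_minus field_simps)
qed

text \<open>Weights of at most 1/2 satisfy \<open>1 - x \<ge> exp (- 2 * x)\<close>, so the product
  over \<open>N i\<close> gives way to the exponential of a sum, and checking the hypothesis becomes
  a matter of adding up weights.\<close>

lemma (in prob_space) local_lemma_exp:
  fixes A :: "'i \<Rightarrow> 'a set" and x :: "'i \<Rightarrow> real"
  assumes fin: "finite I"
    and ev: "\<And>i. i \<in> I \<Longrightarrow> A i \<in> events"
    and x: "\<And>i. i \<in> I \<Longrightarrow> 0 \<le> x i \<and> x i \<le> 1 / 2"
    and N: "\<And>i. i \<in> I \<Longrightarrow> N i \<subseteq> I"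
    and indep: "\<And>i J. i \<in> I \<Longrightarrow> J \<subseteq> I - N i - {i} \<Longrightarrow>
      prob (A i \<inter> (space M - (\<Union>j\<in>J. A j))) = prob (A i) * prob (space M - (\<Union>j\<in>J. A j))"
    and bound: "\<And>i. i \<in> I \<Longrightarrow> prob (A i) \<le> x i * exp (- 2 * (\<Sum>j\<in>N i. x j))"
  shows "prob (space M - (\<Union>i\<in>I. A i)) > 0"
proof (rule local_lemma[where x = x and N = N])
  fix i assume i: "i \<in> I"
  have "finite (N i)" using N[OF i] fin finite_subset by blast
  then have "exp (- 2 * (\<Sum>j\<in>N i. x j)) = (\<Prod>j\<in>N i. exp (- 2 * x j))"
    by (simp add: sum_distrib_left exp_sum)
  also have "\<dots> \<le> (\<Prod>j\<in>N i. 1 - x j)"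
    using x N[OF i] by (intro prod_mono conjI exp_minus_two_le) auto
  finally show "prob (A i) \<le> x i * (\<Prod>j\<in>N i. 1 - x j)"
    using bound[OF i] x[OF i] by (smt (verit) mult_left_mono)
qed (use assms in force)+

section \<open>Independent Bernoulli choices on a finite set\<close>

text \<open>The law on \<open>E\<close> is the image of independent laws on \<open>D\<close> and
  \<open>E - D\<close>, and an intersection of events depending on these two coordinate sets pulls
  back to a rectangle.\<close>

lemma prob_Pi_pmf_disjoint_support:
  assumes "finite E" "D \<subseteq> E"
    and A: "\<And>f g. (\<And>e. e \<in> D \<Longrightarrow> f e = g e) \<Longrightarrow> f \<in> A \<longleftrightarrow> g \<in> A"
    and B: "\<And>f g. (\<And>e. e \<in> E - D \<Longrightarrow> f e = g e) \<Longrightarrow> f \<in> B \<longleftrightarrow> g \<in> B"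
  shows "measure_pmf.prob (Pi_pmf E dflt q) (A \<inter> B) =
    measure_pmf.prob (Pi_pmf E dflt q) A * measure_pmf.prob (Pi_pmf E dflt q) B"
proof -
  define P where "P = Pi_pmf D dflt q"
  define R where "R = Pi_pmf (E - D) dflt q"
  have E: "Pi_pmf E dflt q = map_pmf (\<lambda>(f,g) x. if x \<in> D then f x else g x) (pair_pmf P R)"
    unfolding P_def R_def using assms(1,2) finite_subset
      Pi_pmf_union[of D "E - D" dflt q] by (auto simp: Un_absorb1)
  have fact: "measure_pmf.prob (Pi_pmf E dflt q) (A' \<inter> B') = measure_pmf.prob P A' * measure_pmf.prob R B'"
    if A': "\<And>f g. (\<And>e. e \<in> D \<Longrightarrow> f e = g e) \<Longrightarrow> f \<in> A' \<longleftrightarrow> g \<in> A'"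
      and B': "\<And>f g. (\<And>e. e \<in> E - D \<Longrightarrow> f e = g e) \<Longrightarrow> f \<in> B' \<longleftrightarrow> g \<in> B'" for A' B'
  proof -
    have "(\<lambda>x. if x \<in> D then f x else g x) \<in> A' \<longleftrightarrow> f \<in> A'"
      "(\<lambda>x. if x \<in> D then f x else g x) \<in> B' \<longleftrightarrow> g \<in> B'" for f g
      by (rule A', simp) (rule B', simp)
    then have "(\<lambda>(f,g) x. if x \<in> D then f x else g x) -` (A' \<inter> B') = A' \<times> B'"
      by (auto split: prod.splits)
    then have "measure_pmf.prob (Pi_pmf E dflt q) (A' \<inter> B') = measure_pmf.prob (pair_pmf P R) (A' \<times> B')"
      unfolding E by simp
    \<comment> \<open>The product rule is applied to countable sets; intersecting with the supports
      makes both factors countable.\<close>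
    also have "\<dots> = measure_pmf.prob (pair_pmf P R) ((A' \<inter> set_pmf P) \<times> (B' \<inter> set_pmf R))"
      by (subst measure_Int_set_pmf[symmetric]) (simp add: Times_Int_Times)
    also have "\<dots> = measure_pmf.prob P A' * measure_pmf.prob R B'"
      by (subst measure_pmf_prob_product) (auto simp: measure_Int_set_pmf)
    finally show ?thesis .
  qed
  \<comment> \<open>Taking \<open>UNIV\<close> for one of the two events turns \<open>fact\<close>
    into a formula for each marginal.\<close>
  show ?thesis
    using fact[OF A B] fact[OF A, of UNIV] fact[OF _ B, of UNIV] by simp
qed

lemma prob_bernoulli_all:
  assumes "finite E" "C \<subseteq> E" "0 \<le> p" "p \<le> 1"
  shows "measure_pmf.prob (Pi_pmf E False (\<lambda>_. bernoulli_pmf p)) {f. \<forall>e\<in>C. f e} = p ^ card C"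
proof -
  have "{f. \<forall>e\<in>C. f e} = Pi E (\<lambda>e. if e \<in> C then {True} else UNIV)"
    using assms(2) by (auto simp: Pi_def)
  then have "measure_pmf.prob (Pi_pmf E False (\<lambda>_. bernoulli_pmf p)) {f. \<forall>e\<in>C. f e} =
    (\<Prod>e\<in>E. measure_pmf.prob (bernoulli_pmf p) (if e \<in> C then {True} else UNIV))"
    using assms by (simp add: measure_Pi_pmf_Pi)
  also have "\<dots> = (\<Prod>e\<in>E. if e \<in> C then p else 1)"
    using assms by (intro prod.cong) (auto simp: measure_pmf_single)
  also have "\<dots> = p ^ card C"
    using assms by (simp add: prod.If_cases Int_absorb1)
  finally show ?thesis .
qed

text \<open>Chernoff bound: Markov's inequality for \<open>exp (- X)\<close>, where \<open>X\<close>
  counts the chosen elements of \<open>D\<close>. The expectation is at most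
  \<open>exp (- (3 / 5) * p * card D)\<close>, the threshold is
  \<open>exp (- p * card D / 4)\<close>, and 3/5 - 1/4 = 7/20.\<close>

lemma prob_bernoulli_few:
  assumes "finite E" "D \<subseteq> E" "0 \<le> p" "p \<le> 1"
  shows "measure_pmf.prob (Pi_pmf E False (\<lambda>_. bernoulli_pmf p))
    {f. real (card {e \<in> D. f e}) < p * real (card D) / 4} \<le> exp (- (7 / 20) * p * real (card D))"
proof -
  define P where "P = Pi_pmf E False (\<lambda>_. bernoulli_pmf p)"
  \<comment> \<open>The product runs over all of \<open>E\<close>, with factor 1 outside
    \<open>D\<close>, so that the expectation factorises over the coordinates.\<close>
  define u :: "('a \<Rightarrow> bool) \<Rightarrow> real" where "u f = (\<Prod>e\<in>E. if e \<in> D \<and> f e then exp (-1) else 1)" for f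
  define c where "c = exp (- (p * real (card D) / 4))"
  have finD: "finite D" using assms finite_subset by blast
  have u: "u f = exp (- real (card {e \<in> D. f e}))" for f
  proof -
    have "E \<inter> {e. e \<in> D \<and> f e} = {e \<in> D. f e}" using assms by auto
    then have "u f = exp (-1) ^ card {e \<in> D. f e}"
      unfolding u_def using assms by (simp add: prod.If_cases)
    then show ?thesis by (simp add: exp_of_nat_mult[symmetric])
  qed
  have "measure_pmf.expectation P u =
      (\<Prod>e\<in>E. measure_pmf.expectation (bernoulli_pmf p) (\<lambda>b. if e \<in> D \<and> b then exp (-1) else 1))"
    unfolding P_def u_def using assms
    by (intro expectation_prod_Pi_pmf) (auto intro: integrable_measure_pmf_finite)
  also have "\<dots> = (\<Prod>e\<in>E. if e \<in> D then exp (-1) * p + (1 - p) else 1)"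
    using assms by (intro prod.cong) auto
  also have "\<dots> = (exp (-1) * p + (1 - p)) ^ card D"
    using assms by (simp add: prod.If_cases Int_absorb1)
  also have "\<dots> \<le> exp (- (3 / 5) * p) ^ card D"
  proof (rule power_mono)
    have "5 / 2 \<le> exp (1 :: real)" using exp_lower_Taylor_quadratic[of 1] by simp
    then have "exp (-1 :: real) \<le> 2 / 5" by (simp add: exp_minus field_simps)
    then have "exp (-1) * p \<le> 2 / 5 * p" using assms by (intro mult_right_mono)
    then show "exp (-1) * p + (1 - p) \<le> exp (- (3 / 5) * p)"
      using exp_ge_add_one_self[of "- (3 / 5) * p"] by simp
  qed (use assms in auto)
  also have "\<dots> = exp (- (3 / 5) * p * real (card D))"
    by (simp add: exp_of_nat_mult[symmetric] algebra_simps)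
  finally have E: "measure_pmf.expectation P u \<le> exp (- (3 / 5) * p * real (card D))" .
  have "finite (set_pmf P)"
    unfolding P_def by (simp add: set_Pi_pmf[OF assms(1)] finite_PiE_dflt assms(1))
  then have "integrable (measure_pmf P) u" by (rule integrable_measure_pmf_finite)
  then have "measure_pmf.prob P {f \<in> space (measure_pmf P). u f \<ge> c} \<le> measure_pmf.expectation P u / c"
    by (rule integral_Markov_inequality_measure) (auto simp: u c_def)
  also have "\<dots> \<le> exp (- (3 / 5) * p * real (card D)) / c"
    using E by (intro divide_right_mono) (auto simp: c_def)
  also have "\<dots> = exp (- (7 / 20) * p * real (card D))"
    unfolding c_def by (simp add: exp_diff[symmetric] algebra_simps)
  finally have *: "measure_pmf.prob P {f \<in> space (measure_pmf P). u f \<ge> c} \<le> exp (- (7 / 20) * p * real (card D))" .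
  have "measure_pmf.prob P {f. real (card {e \<in> D. f e}) < p * real (card D) / 4}
      \<le> measure_pmf.prob P {f \<in> space (measure_pmf P). u f \<ge> c}"
    by (intro measure_pmf.finite_measure_mono) (auto simp: u c_def)
  with * show ?thesis unfolding P_def by linarith
qed

section \<open>Connected vertex sets, boundaries and cycles\<close>

definition adj :: "'a graph \<Rightarrow> 'a \<Rightarrow> 'a \<Rightarrow> bool" where
  "adj G u v \<longleftrightarrow> {u, v} \<in> edges G"

text \<open>Connectedness of the induced subgraph \<open>G[T]\<close>, phrased through cuts.\<close>

definition linked :: "'a graph \<Rightarrow> 'a set \<Rightarrow> bool" where
  "linked G T \<longleftrightarrow> T \<noteq> {} \<and> (\<forall>U\<subset>T. U \<noteq> {} \<longrightarrow> (\<exists>u\<in>U. \<exists>v\<in>T - U. adj G u v))"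

definition walks :: "'a graph \<Rightarrow> 'a \<Rightarrow> nat \<Rightarrow> 'a list set" where
  "walks G x l = {w. length w = Suc l \<and> hd w = x \<and> successively (adj G) w}"

lemma adj_verts: "simple_graph G \<Longrightarrow> adj G u v \<Longrightarrow> u \<in> verts G \<and> v \<in> verts G \<and> u \<noteq> v"
  unfolding simple_graph_def adj_def by fastforce

lemma simple_graph_edgeE:
  assumes "simple_graph G" "e \<in> edges G"
  obtains u v where "e = {u, v}" "u \<noteq> v" "u \<in> verts G" "v \<in> verts G"
  using assms unfolding simple_graph_def by (metis card_2_iff insert_subset)

lemma finite_graph_finite_edges: "finite_graph G \<Longrightarrow> finite (edges G)"
  unfolding finite_graph_def simple_graph_def
  by (rule finite_subset[of _ "Pow (verts G)"]) auto

lemma adj_commute: "adj G u v \<Longrightarrow> adj G v u"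
  by (simp add: adj_def insert_commute)

section \<open>Walks and the number of connected sets\<close>

lemma neighbours_le:
  assumes "finite_graph G" "regular d G" "x \<in> verts G"
  shows "finite {y. adj G x y}" "card {y. adj G x y} \<le> d"
proof -
  have inj: "inj_on (\<lambda>y. {x, y}) {y. adj G x y}" by (auto simp: inj_on_def doubleton_eq_iff)
  have sub: "(\<lambda>y. {x, y}) ` {y. adj G x y} \<subseteq> {e \<in> edges G. x \<in> e}" by (auto simp: adj_def)
  have fin: "finite {e \<in> edges G. x \<in> e}" using finite_graph_finite_edges[OF assms(1)] by simp
  show "finite {y. adj G x y}" using inj_on_finite[OF inj sub fin] .
  show "card {y. adj G x y} \<le> d"
    using card_inj_on_le[OF inj sub fin] assms unfolding regular_def by simp
qed

lemma walks_Suc: "walks G x (Suc l) = (\<Union>y\<in>{y. adj G x y}. (#) x ` walks G y l)"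
proof (rule set_eqI)
  fix w
  show "w \<in> walks G x (Suc l) \<longleftrightarrow> w \<in> (\<Union>y\<in>{y. adj G x y}. (#) x ` walks G y l)"
    by (cases w) (auto simp: walks_def successively_Cons image_iff)
qed

lemma card_walks_le:
  assumes G: "finite_graph G" "regular d G" and "x \<in> verts G"
  shows "finite (walks G x l) \<and> card (walks G x l) \<le> d ^ l"
  using assms(3)
proof (induction l arbitrary: x)
  case 0
  have "walks G x 0 = {[x]}" by (auto simp: walks_def length_Suc_conv)
  then show ?case by simp
next
  case (Suc l)
  have IH: "finite (walks G y l) \<and> card (walks G y l) \<le> d ^ l" if "adj G x y" for y
    using Suc.IH adj_verts[OF _ that] G by (auto simp: finite_graph_def)
  note nb = neighbours_le[OF G Suc.prems]
  have "card (walks G x (Suc l)) \<le> (\<Sum>y\<in>{y. adj G x y}. card ((#) x ` walks G y l))"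
    unfolding walks_Suc by (rule card_UN_le[OF nb(1)])
  also have "\<dots> \<le> (\<Sum>y\<in>{y. adj G x y}. d ^ l)"
    using IH by (intro sum_mono) (metis card_image_le le_trans mem_Collect_eq)
  also have "\<dots> \<le> d * d ^ l" using nb(2) by simp
  finally show ?case using nb(1) IH by (simp add: walks_Suc)
qed

text \<open>Splicing the detour \<open>u, v, u\<close> into the walk keeps the rest of it intact, so
  a neighbour is collected at the price of two steps.\<close>

lemma walk_detour:
  assumes "w \<in> walks G x l" "u \<in> set w" "adj G u v"
  shows "\<exists>w'\<in>walks G x (l + 2). set w' = insert v (set w)"
proof -
  obtain as bs where w: "w = as @ u # bs" using split_list[OF assms(2)] by blast
  have "as @ u # v # u # bs \<in> walks G x (l + 2)"
    using assms(1) adj_commute[OF assms(3)] assms(3) unfolding w walks_def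
    by (cases as) (auto simp: successively_append_iff successively_Cons hd_append)
  then show ?thesis using w by (intro bexI[of _ "as @ u # v # u # bs"]) auto
qed

text \<open>Greedy exploration: while the visited set is a proper subset of \<open>T\<close>,
  linkedness gives an edge from it to a new vertex of \<open>T\<close>, which
  \<open>walk_detour\<close> adds. Hence \<open>j\<close> further vertices cost \<open>2 * j\<close>
  steps.\<close>

lemma linked_partial_walk:
  assumes "linked G T" "finite T" "x \<in> T" "j < card T"
  shows "\<exists>w\<in>walks G x (2 * j). set w \<subseteq> T \<and> card (set w) = Suc j"
  using assms(4)
proof (induction j)
  case 0
  then show ?case using assms(3) by (intro bexI[of _ "[x]"]) (auto simp: walks_def)
next
  case (Suc j)
  then obtain w where w: "w \<in> walks G x (2 * j)" "set w \<subseteq> T" "card (set w) = Suc j" by auto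
  have "set w \<subset> T" "set w \<noteq> {}" using w Suc.prems by auto
  then obtain u v where uv: "u \<in> set w" "v \<in> T - set w" "adj G u v"
    using assms(1) unfolding linked_def by blast
  obtain w' where "w' \<in> walks G x (2 * j + 2)" "set w' = insert v (set w)"
    using walk_detour[OF w(1) uv(1,3)] by auto
  then show ?case using w uv by (intro bexI[of _ w']) auto
qed

text \<open>Each such set is the vertex set of a walk with \<open>2 * j\<close> steps from
  \<open>x\<close>, so the number of walks bounds the number of sets.\<close>

lemma card_linked_le:
  assumes "finite_graph G" "regular d G" "x \<in> verts G"
  shows "card {T. T \<subseteq> verts G \<and> linked G T \<and> x \<in> T \<and> card T = Suc j} \<le> d ^ (2 * j)"
proof -
  have "{T. T \<subseteq> verts G \<and> linked G T \<and> x \<in> T \<and> card T = Suc j} \<subseteq> set ` walks G x (2 * j)"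
  proof
    fix T assume T: "T \<in> {T. T \<subseteq> verts G \<and> linked G T \<and> x \<in> T \<and> card T = Suc j}"
    then have "finite T" using assms(1) finite_subset by (auto simp: finite_graph_def)
    then obtain w where "w \<in> walks G x (2 * j)" "set w \<subseteq> T" "card (set w) = Suc j"
      using linked_partial_walk[of G T x j] T by auto
    then show "T \<in> set ` walks G x (2 * j)" using T \<open>finite T\<close> card_subset_eq[of T "set w"] by auto
  qed
  then show ?thesis
    using card_walks_le[OF assms, of "2 * j"] surj_card_le[of "walks G x (2 * j)" _ set]
    by (meson le_trans)
qed

section \<open>Edge boundaries and their decomposition\<close>

lemma mem_edge_boundary:
  assumes "simple_graph G" "adj G u v"
  shows "{u, v} \<in> edge_boundary G S \<longleftrightarrow> (u \<in> S) \<noteq> (v \<in> S)"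
  using assms(2) adj_verts[OF assms]
  by (cases "u \<in> S"; cases "v \<in> S") (simp_all add: edge_boundary_def adj_def)

lemma edge_boundary_mono_graph:
  "edges H \<subseteq> edges G \<Longrightarrow> edge_boundary H S = edge_boundary G S \<inter> edges H"
  by (auto simp: edge_boundary_def)

text \<open>With no edge between \<open>U\<close> and \<open>S - U\<close>, a boundary edge of
  either part leaves \<open>S\<close> altogether, so it is a boundary edge of \<open>S\<close> and
  of exactly one part.\<close>

lemma edge_boundary_split:
  assumes G: "simple_graph G" and "U \<subseteq> S"
    and sep: "\<And>u v. u \<in> U \<Longrightarrow> v \<in> S - U \<Longrightarrow> \<not> adj G u v"
  shows "edge_boundary G S = edge_boundary G U \<union> edge_boundary G (S - U)"
    and "edge_boundary G U \<inter> edge_boundary G (S - U) = {}"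
proof -
  have split: "(e \<in> edge_boundary G S \<longleftrightarrow> e \<in> edge_boundary G U \<or> e \<in> edge_boundary G (S - U)) \<and>
      \<not> (e \<in> edge_boundary G U \<and> e \<in> edge_boundary G (S - U))" for e
  proof (cases "e \<in> edges G")
    case True
    obtain u v where e: "e = {u, v}" using simple_graph_edgeE[OF G True] by metis
    with True have uv: "adj G u v" "adj G v u" by (auto simp: adj_def insert_commute)
    then have "\<not> (u \<in> U \<and> v \<in> S - U)" "\<not> (v \<in> U \<and> u \<in> S - U)" using sep by blast+
    then show ?thesis unfolding e mem_edge_boundary[OF G uv(1)] using assms(2) by blast
  qed (simp add: edge_boundary_def)
  show "edge_boundary G S = edge_boundary G U \<union> edge_boundary G (S - U)"
    using split by blast
  show "edge_boundary G U \<inter> edge_boundary G (S - U) = {}"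
    using split by blast
qed

lemma boundary_le_if_linked:
  fixes c :: real
  assumes H: "edges H \<subseteq> edges G" and G: "finite_graph G"
    and "\<And>T. T \<subseteq> S \<Longrightarrow> linked G T \<Longrightarrow>
      c * real (card (edge_boundary G T)) \<le> real (card (edge_boundary H T))"
    and "finite S"
  shows "c * real (card (edge_boundary G S)) \<le> real (card (edge_boundary H S))"
  \<comment> \<open>The boundary of \<open>S\<close> is the disjoint union of the boundaries of the components of \<open>G[S]\<close>.\<close>
  using assms(3,4)
proof (induction "card S" arbitrary: S rule: less_induct)
  case less
  have simp: "simple_graph G" using G by (simp add: finite_graph_def)
  have fin: "finite (edge_boundary G T)" for T
    using finite_graph_finite_edges[OF G] by (simp add: edge_boundary_def)
  consider "linked G S" | "S = {}" | "S \<noteq> {}" "\<not> linked G S" by blast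
  then show ?case
  proof cases
    case 1
    then show ?thesis using less by blast
  next
    case 2
    then show ?thesis by (simp add: edge_boundary_def)
  next
    case 3
    then obtain U where U: "U \<subset> S" "U \<noteq> {}" and sep: "\<And>u v. u \<in> U \<Longrightarrow> v \<in> S - U \<Longrightarrow> \<not> adj G u v"
      unfolding linked_def by blast
    note split = edge_boundary_split[OF simp psubset_imp_subset[OF U(1)] sep]
    have c: "card U < card S" "card (S - U) < card S"
      using U less.prems(2) by (auto intro!: psubset_card_mono)
    have "c * real (card (edge_boundary G U)) \<le> real (card (edge_boundary H U))"
      using U less.prems(1) finite_subset[OF _ less.prems(2)] by (intro less.hyps[OF c(1)]) auto
    moreover have "c * real (card (edge_boundary G (S - U))) \<le> real (card (edge_boundary H (S - U)))"
      using less.prems by (intro less.hyps[OF c(2)]) auto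
    moreover have "card (edge_boundary G S) = card (edge_boundary G U) + card (edge_boundary G (S - U))"
      using card_Un_disjoint[OF fin fin split(2)] split(1) by simp
    \<comment> \<open>The separation is known in \<open>G\<close>; it passes to \<open>H\<close>
      because boundaries in \<open>H\<close> are those of \<open>G\<close> intersected with the
      edges of \<open>H\<close>.\<close>
    moreover have "card (edge_boundary H S) = card (edge_boundary H U) + card (edge_boundary H (S - U))"
    proof -
      have "edge_boundary H S = edge_boundary H U \<union> edge_boundary H (S - U)"
        "edge_boundary H U \<inter> edge_boundary H (S - U) = {}"
        using split unfolding edge_boundary_mono_graph[OF H] by blast+
      then show ?thesis
        using card_Un_disjoint fin unfolding edge_boundary_mono_graph[OF H] by (metis finite_Int)
    qed
    ultimately show ?thesis by (simp add: algebra_simps)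
  qed
qed

section \<open>Cycles as edge sets\<close>

lemma Union_cyclic_edges: "\<Union>(cyclic_edges w) \<subseteq> set w"
  unfolding cyclic_edges_def by (force intro: nth_mem mod_less_divisor)

lemma card_cyclic_edges:
  assumes "distinct w" "3 \<le> length w"
  shows "card (cyclic_edges w) = length w"
proof -
  have "inj_on (\<lambda>i. {w ! i, w ! (Suc i mod length w)}) {..<length w}"
  proof (rule inj_onI)
    fix i j assume ij: "i \<in> {..<length w}" "j \<in> {..<length w}"
      "{w ! i, w ! (Suc i mod length w)} = {w ! j, w ! (Suc j mod length w)}"
    have "Suc i mod length w < length w" "Suc j mod length w < length w"
      using assms by (auto intro: mod_less_divisor)
    with ij have "i = j \<or> (i = Suc j mod length w \<and> j = Suc i mod length w)"
      using assms by (auto simp: doubleton_eq_iff nth_eq_iff_index_eq)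
    \<comment> \<open>Two indices that are cyclic successors of each other force the length to
      divide 2, contrary to \<open>3 \<le> length w\<close>.\<close>
    then show "i = j" using ij assms(2) by (auto simp: mod_Suc split: if_splits)
  qed
  moreover have "cyclic_edges w = (\<lambda>i. {w ! i, w ! (Suc i mod length w)}) ` {..<length w}"
    unfolding cyclic_edges_def by auto
  ultimately show ?thesis by (simp add: card_image)
qed

lemma cycles_facts:
  assumes "C \<in> cycles G k"
  shows "C \<subseteq> edges G" "3 \<le> k" "card C = k" "card (\<Union>C) \<le> k" "\<Union>C \<noteq> {}"
proof -
  obtain w where w: "distinct w" "length w = k" "3 \<le> k" "C = cyclic_edges w" "C \<subseteq> edges G"
    using assms by (auto simp: cycles_def)
  show "C \<subseteq> edges G" "3 \<le> k" "card C = k" using w card_cyclic_edges by auto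
  have sub: "\<Union>C \<subseteq> set w" using w Union_cyclic_edges by simp
  show "card (\<Union>C) \<le> k" using card_mono[OF _ sub] distinct_card[OF w(1)] w by simp
  have "{w ! 0, w ! (Suc 0 mod length w)} \<in> C"
    unfolding w(4) cyclic_edges_def using w(2,3) by (intro CollectI exI[of _ 0]) simp
  then show "\<Union>C \<noteq> {}" by blast
qed

lemma girth_geI:
  assumes "\<And>k. k < g \<Longrightarrow> cycles H k = {}"
  shows "girth H \<ge> enat g"
  unfolding girth_def
proof (rule INF_greatest)
  fix k assume "k \<in> {k. cycles H k \<noteq> {}}"
  then show "enat g \<le> enat k" using assms[of k] by (cases "k < g") auto
qed

section \<open>Random spanning subgraphs\<close>

text \<open>Union bound. In the application \<open>R w j\<close> says that the object
  \<open>j\<close> contains the vertex \<open>w\<close>, so a bound on the weight through a single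
  vertex controls all objects meeting a vertex set.\<close>

lemma sum_cover_le:
  fixes y :: "'j \<Rightarrow> real"
  assumes J: "finite J" and "finite W" and y: "\<And>j. j \<in> J \<Longrightarrow> 0 \<le> y j"
    and b: "\<And>w. w \<in> W \<Longrightarrow> (\<Sum>j\<in>{j \<in> J. R w j}. y j) \<le> b"
  shows "(\<Sum>j\<in>{j \<in> J. \<exists>w\<in>W. R w j}. y j) \<le> real (card W) * b"
  using assms(2) b
proof (induction W rule: finite_induct)
  case empty
  then show ?case by simp
next
  case (insert w W)
  have "{j \<in> J. \<exists>w\<in>insert w W. R w j} = {j \<in> J. R w j} \<union> {j \<in> J. \<exists>w\<in>W. R w j}" by blast
  then have "(\<Sum>j\<in>{j \<in> J. \<exists>w\<in>insert w W. R w j}. y j)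
      \<le> (\<Sum>j\<in>{j \<in> J. R w j}. y j) + (\<Sum>j\<in>{j \<in> J. \<exists>w\<in>W. R w j}. y j)"
    using sum_Un[of "{j \<in> J. R w j}" "{j \<in> J. \<exists>w\<in>W. R w j}" y] J y
      sum_nonneg[of "{j \<in> J. R w j} \<inter> {j \<in> J. \<exists>w\<in>W. R w j}" y] by auto
  also have "\<dots> \<le> b + real (card W) * b"
    using insert.IH insert.prems by (intro add_mono) auto
  finally show ?case using insert.hyps by (simp add: algebra_simps)
qed

lemma geometric_sum_le:
  fixes c :: real
  assumes "0 \<le> c" "c < 1"
  shows "(\<Sum>k\<in>{m..<n}. c ^ k) \<le> c ^ m / (1 - c)"
proof (cases "m < n")
  case True
  then obtain n' where n: "n = Suc n'" "m \<le> n'" by (cases n) auto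
  have "(1 - c) * (\<Sum>k\<in>{m..<n}. c ^ k) = c ^ m - c ^ n"
    using sum_gp_multiplied[OF n(2), of c] n by (simp add: atLeastLessThanSuc_atLeastAtMost)
  also have "\<dots> \<le> c ^ m" using assms by simp
  finally show ?thesis using assms by (simp add: field_simps)
qed (use assms in simp)

lemma finite_cycles: "finite_graph G \<Longrightarrow> finite (cycles G k)"
  using finite_graph_finite_edges cycles_facts(1)
  by (metis finite_Pow_iff PowI finite_subset subsetI)

text \<open>With \<open>p = \<delta> / d\<close>, at most \<open>(1 / (8 * p)) ^ k\<close> cycles of
  length \<open>k\<close> pass through \<open>x\<close>, each of weight \<open>(2 * p) ^ k\<close>,
  which leaves \<open>(1 / 4) ^ k\<close>. Cycle lengths start at 3, and the geometric series from
  there sums to 1/48.\<close>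

lemma cycle_weight_le:
  assumes G: "finite_graph G" and pos: "0 < d" "0 < \<delta>"
    and few: "\<And>k. k \<le> g \<Longrightarrow> real (card (cycles_through G k x)) \<le> (real d / (8 * real \<delta>)) ^ k"
  shows "(\<Sum>C\<in>{C \<in> \<Union>k<g. cycles G k. x \<in> \<Union>C}. (2 * (real \<delta> / real d)) ^ card C) \<le> 1 / 48"
    (is "sum ?y ?S \<le> _")
proof -
  have fin: "finite ?S" using finite_cycles[OF G] by simp
  have "card ` ?S \<subseteq> {3..<g}" using cycles_facts(2,3)[of _ G] by fastforce
  then have "sum ?y ?S = (\<Sum>k\<in>{3..<g}. \<Sum>C\<in>{C \<in> ?S. card C = k}. ?y C)"
    by (intro sum.group[symmetric] fin) auto
  also have "\<dots> = (\<Sum>k\<in>{3..<g}. real (card (cycles_through G k x)) * (2 * (real \<delta> / real d)) ^ k)"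
  proof (rule sum.cong)
    fix k assume "k \<in> {3..<g}"
    then have "{C \<in> ?S. card C = k} = cycles_through G k x"
      unfolding cycles_through_def using cycles_facts(3)[of _ G] by fastforce
    moreover have "card C = k" if "C \<in> cycles_through G k x" for C
      using that cycles_facts(3) unfolding cycles_through_def by blast
    ultimately show "(\<Sum>C\<in>{C \<in> ?S. card C = k}. ?y C)
        = real (card (cycles_through G k x)) * (2 * (real \<delta> / real d)) ^ k"
      by simp
  qed simp
  also have "\<dots> \<le> (\<Sum>k\<in>{3..<g}. (1 / 4) ^ k)"
  proof (rule sum_mono)
    fix k assume "k \<in> {3..<g}"
    then have "real (card (cycles_through G k x)) * (2 * (real \<delta> / real d)) ^ k
        \<le> (real d / (8 * real \<delta>)) ^ k * (2 * (real \<delta> / real d)) ^ k"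
      by (intro mult_right_mono few) auto
    also have "\<dots> = (1 / 4) ^ k"
      using pos by (simp add: power_mult_distrib[symmetric])
    finally show "real (card (cycles_through G k x)) * (2 * (real \<delta> / real d)) ^ k \<le> (1 / 4) ^ k" .
  qed
  also have "\<dots> \<le> 1 / 48" using geometric_sum_le[of "1 / 4" 3 g] by (simp add: power3_eq_cube)
  finally show ?thesis .
qed

text \<open>A connected set of size \<open>t\<close> containing \<open>x\<close> is visited by a walk of length \<open>2t - 2\<close> from \<open>x\<close>,
  so there are at most \<open>d\<^sup>2\<^sup>t\<^sup>-\<^sup>2\<close> of them; the weight \<open>(d e\<^sup>2)\<^sup>-\<^sup>2\<^sup>t\<close> makes the sum over \<open>t\<close> geometric.\<close>

lemma linked_weight_le:
  assumes G: "finite_graph G" "regular d G" and x: "x \<in> verts G" and d: "0 < d"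
  shows "(\<Sum>T\<in>{T. T \<subseteq> verts G \<and> linked G T \<and> x \<in> T}. exp (- 2 * (ln (real d) + 2) * real (card T)))
    \<le> 1 / (12 * real d ^ 2)"
    (is "sum ?y ?S \<le> _")
proof -
  have V: "finite (verts G)" using G by (simp add: finite_graph_def)
  then have fin: "finite ?S" by simp
  have pos: "0 < card T" if "T \<in> ?S" for T
    using that finite_subset[OF _ V, of T] by (auto simp: card_gt_0_iff linked_def)
  have "card ` ?S \<subseteq> {1..<Suc (card (verts G))}"
    using pos card_mono[OF V] by (force simp: Suc_le_eq less_Suc_eq_le)
  then have "sum ?y ?S = (\<Sum>k\<in>{1..<Suc (card (verts G))}. \<Sum>T\<in>{T \<in> ?S. card T = k}. ?y T)"
    by (intro sum.group[symmetric] fin) auto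
  also have "\<dots> \<le> (\<Sum>k\<in>{1..<Suc (card (verts G))}. (1 / 13) ^ k / real d ^ 2)"
  proof (rule sum_mono)
    fix k assume "k \<in> {1..<Suc (card (verts G))}"
    then obtain j where k: "k = Suc j" by (cases k) auto
    \<comment> \<open>\<open>exp 4\<close> is at least 1 + 4 + 8 = 13, and the powers of 1/13 from
      exponent 1 on sum to at most 1/12.\<close>
    have e: "exp (-4 :: real) \<le> 1 / 13"
      using exp_lower_Taylor_quadratic[of 4] by (simp add: exp_minus field_simps)
    have "exp (- 2 * (ln (real d) + 2) * real k) = exp (ln (1 / real d ^ 2) + (-4)) ^ k"
      using d by (simp add: exp_of_nat_mult[symmetric] ln_div ln_realpow algebra_simps)
    also have "\<dots> = (1 / real d ^ 2) ^ k * exp (-4) ^ k"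
      unfolding exp_add power_mult_distrib using d by simp
    finally have y: "exp (- 2 * (ln (real d) + 2) * real k) = (1 / real d ^ 2) ^ k * exp (-4) ^ k" .
    have S: "{T \<in> ?S. card T = k} = {T. T \<subseteq> verts G \<and> linked G T \<and> x \<in> T \<and> card T = Suc j}"
      using k by auto
    have "(\<Sum>T\<in>{T \<in> ?S. card T = k}. ?y T)
        = real (card {T \<in> ?S. card T = k}) * exp (- 2 * (ln (real d) + 2) * real k)"
      by simp
    also have "\<dots> \<le> real (d ^ (2 * j)) * exp (- 2 * (ln (real d) + 2) * real k)"
      unfolding S using card_linked_le[OF G x, of j] by (intro mult_right_mono of_nat_mono) auto
    \<comment> \<open>Since \<open>k = j + 1\<close>, the count \<open>d ^ (2 * j)\<close> cancels
      all but \<open>1 / d ^ 2\<close> of the factor \<open>(1 / d ^ 2) ^ k\<close>.\<close>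
    also have "\<dots> = exp (-4) ^ k / real d ^ 2"
      unfolding y using d k by (simp add: power_mult power_divide)
    also have "\<dots> \<le> (1 / 13) ^ k / real d ^ 2"
      by (intro divide_right_mono power_mono e) auto
    finally show "(\<Sum>T\<in>{T \<in> ?S. card T = k}. ?y T) \<le> (1 / 13) ^ k / real d ^ 2" .
  qed
  also have "\<dots> = (\<Sum>k\<in>{1..<Suc (card (verts G))}. (1 / 13) ^ k) / real d ^ 2"
    by (simp only: sum_divide_distrib)
  also have "\<dots> \<le> (1 / 12) / real d ^ 2"
    using geometric_sum_le[of "1 / 13" 1 "Suc (card (verts G))"] by (intro divide_right_mono) auto
  finally show ?thesis by simp
qed

lemma card_Union_edges_le:
  assumes "simple_graph G" "D \<subseteq> edges G" "finite D"
  shows "card (\<Union>D) \<le> 2 * card D"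
proof -
  have "card (\<Union>D) \<le> (\<Sum>e\<in>D. card e)" by (rule card_Union_le_sum_card)
  also have "\<dots> = (\<Sum>e\<in>D. 2)"
    using assms by (intro sum.cong) (auto simp: simple_graph_def)
  finally show ?thesis by simp
qed

lemma spanning_subgraph_edges:
  assumes "simple_graph G" "F \<subseteq> edges G"
  shows "spanning_subgraph (verts G, F) G"
  using assms by (auto simp: spanning_subgraph_def simple_graph_def)

lemma cheeger_le_ratio:
  assumes "S \<subseteq> verts G" "0 < card S" "real (card S) \<le> real (card (verts G)) / 2"
  shows "cheeger G \<le> ereal (real (card (edge_boundary G S)) / real (card S))"
  unfolding cheeger_def using assms by (intro INF_lower) auto

lemma cheeger_mono_boundary:
  fixes c :: real
  assumes "0 \<le> c" "verts H = verts G"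
    and "\<And>S. S \<subseteq> verts G \<Longrightarrow> 0 < card S \<Longrightarrow> real (card S) \<le> real (card (verts G)) / 2 \<Longrightarrow>
      c * real (card (edge_boundary G S)) \<le> real (card (edge_boundary H S))"
  shows "ereal c * cheeger G \<le> cheeger H"
  unfolding cheeger_def[of H]
proof (rule INF_greatest)
  fix S assume "S \<in> {S. S \<subseteq> verts H \<and> 0 < card S \<and> real (card S) \<le> real (card (verts H)) / 2}"
  then have S: "S \<subseteq> verts G" "0 < card S" "real (card S) \<le> real (card (verts G)) / 2"
    using assms(2) by auto
  have "ereal c * cheeger G \<le> ereal c * ereal (real (card (edge_boundary G S)) / real (card S))"
    using assms(1) cheeger_le_ratio[OF S] by (intro ereal_mult_left_mono) auto
  also have "\<dots> \<le> ereal (real (card (edge_boundary H S)) / real (card S))"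
    using assms(3)[OF S] by (simp add: divide_right_mono)
  finally show "ereal c * cheeger G \<le> ereal (real (card (edge_boundary H S)) / real (card S))" .
qed

section \<open>Application of the local lemma to a random edge set\<close>

text \<open>The assumption \<open>8 * \<delta> \<le> d\<close> says that
  \<open>p \<le> 1 / 8\<close>; this keeps the cycle weights below 1/2 and the weight of the
  connected sets through a vertex below \<open>p / 96\<close>.\<close>

lemma sparse_expander_exists:
  fixes d g \<delta> :: nat and G :: "'a graph"
  assumes pos: "0 < \<delta>" and dense: "8 * \<delta> \<le> d"
    and G: "finite_graph G" "regular d G"
    and few: "\<And>k x. k \<le> g \<Longrightarrow> x \<in> verts G \<Longrightarrow>
           real (card (cycles_through G k x)) \<le> (real d / (8 * real \<delta>)) ^ k"
    and expand: "cheeger G \<ge> ereal (8 * real d * (ln (real d) + 2) / real \<delta>)"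
  shows "\<exists>F \<subseteq> edges G. (\<forall>k<g. \<forall>C\<in>cycles G k. \<not> C \<subseteq> F) \<and>
    (\<forall>T \<subseteq> verts G. linked G T \<and> real (card T) \<le> real (card (verts G)) / 2 \<longrightarrow>
      real \<delta> / (4 * real d) * real (card (edge_boundary G T)) \<le> real (card (edge_boundary G T \<inter> F)))"
proof -
  define p where "p = real \<delta> / real d"
  define L where "L = ln (real d) + 2"
  define Cyc where "Cyc = (\<Union>k<g. cycles G k)"
  define Con where "Con = {T. T \<subseteq> verts G \<and> linked G T \<and> real (card T) \<le> real (card (verts G)) / 2}"
  \<comment> \<open>\<open>D i\<close> collects the edges on which the event \<open>A i\<close>
    depends; cycles are tagged \<open>Inl\<close>, connected sets \<open>Inr\<close>.\<close>
  define D :: "'a set set + 'a set \<Rightarrow> 'a set set" where "D = case_sum (\<lambda>C. C) (edge_boundary G)"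
  define A :: "'a set set + 'a set \<Rightarrow> ('a set \<Rightarrow> bool) set" where
    "A = case_sum (\<lambda>C. {f. \<forall>e\<in>C. f e})
      (\<lambda>T. {f. real (card {e \<in> edge_boundary G T. f e}) < p * real (card (edge_boundary G T)) / 4})"
  \<comment> \<open>The weights of the local lemma: a cycle of length \<open>k\<close> has probability \<open>p\<^sup>k\<close> and gets \<open>(2p)\<^sup>k\<close>.\<close>
  define x :: "'a set set + 'a set \<Rightarrow> real" where
    "x = case_sum (\<lambda>C. (2 * p) ^ card C) (\<lambda>T. exp (- 2 * L * real (card T)))"
  define I where "I = Cyc <+> Con"
  define N where "N i = {j \<in> I. D j \<inter> D i \<noteq> {}}" for i
  define P where "P = Pi_pmf (edges G) False (\<lambda>_. bernoulli_pmf p)"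
  have d: "0 < d" using pos dense by simp
  have p: "0 < p" "p \<le> 1 / 8"
    using pos dense d of_nat_mono[OF dense, where 'a = real] by (auto simp: p_def field_simps)
  have L: "2 \<le> L" using d by (simp add: L_def)
  have simple: "simple_graph G" and V: "finite (verts G)" using G by (auto simp: finite_graph_def)
  note E = finite_graph_finite_edges[OF G(1)]
  have finCyc: "finite Cyc" using finite_cycles[OF G(1)] by (simp add: Cyc_def)
  have finCon: "finite Con" using V by (simp add: Con_def)
  have C: "C \<subseteq> edges G" "3 \<le> card C" "card (\<Union>C) \<le> card C" if mem: "C \<in> Cyc" for C
  proof -
    obtain k where "C \<in> cycles G k" using mem by (auto simp: Cyc_def)
    note facts = cycles_facts[OF this]
    then show "C \<subseteq> edges G" "3 \<le> card C" "card (\<Union>C) \<le> card C" by simp_all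
  qed
  \<comment> \<open>The lower bound on \<open>cheeger G\<close> enters here: the expected number of
    surviving boundary edges is at least \<open>8 * L * card T\<close>.\<close>
  have T: "T \<subseteq> verts G" "0 < card T" "8 * (L * real (card T)) \<le> p * real (card (edge_boundary G T))"
    if "T \<in> Con" for T
  proof -
    have t: "T \<subseteq> verts G" "T \<noteq> {}" "real (card T) \<le> real (card (verts G)) / 2"
      using that by (auto simp: Con_def linked_def)
    then show "T \<subseteq> verts G" "0 < card T" using finite_subset[OF t(1) V] by (auto simp: card_gt_0_iff)
    then have "ereal (8 * real d * L / real \<delta>)
        \<le> ereal (real (card (edge_boundary G T)) / real (card T))"
      using cheeger_le_ratio[OF t(1) _ t(3)] expand order_trans unfolding L_def by blast
    then show "8 * (L * real (card T)) \<le> p * real (card (edge_boundary G T))"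
      using pos d \<open>0 < card T\<close> by (simp add: p_def field_simps)
  qed
  have D: "D i \<subseteq> edges G" if "i \<in> I" for i
    using that by (auto simp: I_def D_def edge_boundary_def dest: subsetD[OF C(1)])
  have A: "f \<in> A i \<longleftrightarrow> f' \<in> A i" if "\<And>e. e \<in> D i \<Longrightarrow> f e = f' e" for f f' i
  proof (cases i)
    case (Inl C)
    then show ?thesis using that by (auto simp: A_def D_def)
  next
    case (Inr T)
    then have "{e \<in> edge_boundary G T. f e} = {e \<in> edge_boundary G T. f' e}"
      using that by (auto simp: D_def)
    then show ?thesis using Inr by (simp add: A_def)
  qed
  \<comment> \<open>\<open>W\<close> is any vertex set meeting every edge of \<open>D'\<close>. It
    will be the vertex set of a cycle, or \<open>T\<close> when \<open>D'\<close> is the boundary of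
    \<open>T\<close>.\<close>
  have cyc_sum: "(\<Sum>C\<in>{C \<in> Cyc. C \<inter> D' \<noteq> {}}. (2 * p) ^ card C) \<le> real (card W) * (1 / 48)"
    if "W \<subseteq> verts G" "\<And>e. e \<in> D' \<Longrightarrow> e \<inter> W \<noteq> {}" for D' W
  proof -
    have "(\<Sum>C\<in>{C \<in> Cyc. C \<inter> D' \<noteq> {}}. (2 * p) ^ card C)
        \<le> (\<Sum>C\<in>{C \<in> Cyc. \<exists>w\<in>W. w \<in> \<Union>C}. (2 * p) ^ card C)"
      using that(2) p finCyc by (intro sum_mono2) (auto, blast)
    also have "\<dots> \<le> real (card W) * (1 / 48)"
    proof (rule sum_cover_le[OF finCyc finite_subset[OF that(1) V]])
      fix w assume "w \<in> W"
      then show "(\<Sum>C\<in>{C \<in> Cyc. w \<in> \<Union>C}. (2 * p) ^ card C) \<le> 1 / 48"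
        unfolding Cyc_def p_def using that(1) by (intro cycle_weight_le G d pos few) auto
    qed (use p in auto)
    finally show ?thesis .
  qed
  \<comment> \<open>A set whose boundary meets \<open>D'\<close> contains an endpoint of an edge of
    \<open>D'\<close>. The factor \<open>p\<close> is kept so that, for a boundary
    \<open>D'\<close>, the sum stays a small multiple of the Chernoff exponent
    \<open>p * card D'\<close>.\<close>
  have con_sum: "(\<Sum>T\<in>{T \<in> Con. edge_boundary G T \<inter> D' \<noteq> {}}. exp (- 2 * L * real (card T)))
      \<le> real (card (\<Union>D')) * (p / 96)" if D': "D' \<subseteq> edges G" for D'
  proof -
    have W: "\<Union>D' \<subseteq> verts G" using D' simple by (auto simp: simple_graph_def)
    have "(\<Sum>T\<in>{T \<in> Con. edge_boundary G T \<inter> D' \<noteq> {}}. exp (- 2 * L * real (card T)))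
        \<le> (\<Sum>T\<in>{T \<in> Con. \<exists>w\<in>\<Union>D'. w \<in> T}. exp (- 2 * L * real (card T)))"
    proof (rule sum_mono2)
      show "{T \<in> Con. edge_boundary G T \<inter> D' \<noteq> {}} \<subseteq> {T \<in> Con. \<exists>w\<in>\<Union>D'. w \<in> T}"
      proof safe
        fix T e assume "e \<in> edge_boundary G T" "e \<in> D'"
        then have "e \<inter> T \<noteq> {}" by (auto simp: edge_boundary_def)
        then show "\<exists>w\<in>\<Union>D'. w \<in> T" using \<open>e \<in> D'\<close> by blast
      qed
    qed (use finCon in auto)
    also have "\<dots> \<le> real (card (\<Union>D')) * (p / 96)"
    proof (rule sum_cover_le[OF finCon finite_subset[OF W V]])
      fix w assume "w \<in> \<Union>D'"
      then have w: "w \<in> verts G" using W by auto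
      have "(\<Sum>T\<in>{T \<in> Con. w \<in> T}. exp (- 2 * L * real (card T)))
          \<le> (\<Sum>T\<in>{T. T \<subseteq> verts G \<and> linked G T \<and> w \<in> T}. exp (- 2 * L * real (card T)))"
        using V by (intro sum_mono2) (auto simp: Con_def)
      also have "\<dots> \<le> 1 / (12 * real d ^ 2)"
        unfolding L_def by (rule linked_weight_le[OF G w d])
      also have "\<dots> \<le> p / 96"
      proof -
        \<comment> \<open>For \<open>p = \<delta> / d\<close> the claim
          \<open>1 / (12 * d ^ 2) \<le> p / 96\<close> amounts to this inequality.\<close>
        have "8 \<le> real \<delta> * real d"
          using mult_mono[of 1 "real \<delta>" 8 "real d"] pos dense by simp
        then show ?thesis using d by (simp add: p_def field_simps power2_eq_square)
      qed
      finally show "(\<Sum>T\<in>{T \<in> Con. w \<in> T}. exp (- 2 * L * real (card T))) \<le> p / 96" .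
    qed auto
    finally show ?thesis .
  qed
  have N_sum: "(\<Sum>j\<in>N i. x j) = (\<Sum>C\<in>{C \<in> Cyc. C \<inter> D i \<noteq> {}}. (2 * p) ^ card C)
      + (\<Sum>T\<in>{T \<in> Con. edge_boundary G T \<inter> D i \<noteq> {}}. exp (- 2 * L * real (card T)))" for i
  proof -
    have "N i = {C \<in> Cyc. C \<inter> D i \<noteq> {}} <+> {T \<in> Con. edge_boundary G T \<inter> D i \<noteq> {}}"
      by (auto simp: N_def I_def D_def)
    then show ?thesis using finCyc finCon by (simp add: sum.Plus x_def o_def)
  qed
  have "measure_pmf.prob P (space (measure_pmf P) - (\<Union>i\<in>I. A i)) > 0"
  proof (rule measure_pmf.local_lemma_exp[where x = x and N = N])
    show "finite I" using finCyc finCon by (simp add: I_def)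
  next
    fix i assume i: "i \<in> I"
    show "0 \<le> x i \<and> x i \<le> 1 / 2"
    proof (cases i)
      case (Inl C)
      with i have "C \<in> Cyc" by (auto simp: I_def)
      then have "(2 * p) ^ card C \<le> (2 * p) ^ 1"
        using C(2)[of C] p by (intro power_decreasing) auto
      then have "0 \<le> (2 * p) ^ card C \<and> (2 * p) ^ card C \<le> 1 / 2" using p by simp
      then show ?thesis unfolding Inl x_def sum.case .
    next
      case (Inr T)
      with i have "T \<in> Con" by (auto simp: I_def)
      then have "2 * 1 \<le> L * real (card T)"
        using T(2) L by (intro mult_mono) (auto simp: Suc_le_eq)
      then have "exp (- 2 * L * real (card T)) \<le> exp (- 1)" by simp
      also have "\<dots> \<le> (1 / 2 :: real)"
        using exp_ge_add_one_self[of "1 :: real"] by (simp add: exp_minus field_simps)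
      finally show ?thesis using Inr by (simp add: x_def)
    qed
  next
    fix i assume "i \<in> I"
    show "N i \<subseteq> I" by (auto simp: N_def)
  next
    fix i J assume i: "i \<in> I" and J: "J \<subseteq> I - N i - {i}"
    show "measure_pmf.prob P (A i \<inter> (space (measure_pmf P) - (\<Union>j\<in>J. A j))) =
        measure_pmf.prob P (A i) * measure_pmf.prob P (space (measure_pmf P) - (\<Union>j\<in>J. A j))"
      unfolding P_def
    proof (rule prob_Pi_pmf_disjoint_support[OF E D[OF i] A])
      fix f f' :: "'a set \<Rightarrow> bool" assume eq: "\<And>e. e \<in> edges G - D i \<Longrightarrow> f e = f' e"
      \<comment> \<open>For \<open>j\<close> outside \<open>N i\<close> the sets \<open>D j\<close>
        and \<open>D i\<close> are disjoint, so \<open>A j\<close> is determined by the edges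
        outside \<open>D i\<close>.\<close>
      have "f \<in> A j \<longleftrightarrow> f' \<in> A j" if "j \<in> J" for j
        using that J D[of j] by (intro A eq) (auto simp: N_def)
      then show "f \<in> space (measure_pmf (Pi_pmf (edges G) False (\<lambda>_. bernoulli_pmf p))) - (\<Union>j\<in>J. A j)
        \<longleftrightarrow> f' \<in> space (measure_pmf (Pi_pmf (edges G) False (\<lambda>_. bernoulli_pmf p))) - (\<Union>j\<in>J. A j)"
        by simp
    qed
  next
    fix i assume i: "i \<in> I"
    show "measure_pmf.prob P (A i) \<le> x i * exp (- 2 * (\<Sum>j\<in>N i. x j))"
    proof (cases i)
      case (Inl C)
      with i have CC: "C \<in> Cyc" by (auto simp: I_def)
      have CE: "C \<subseteq> edges G" and Di: "D i = C" using C(1)[OF CC] Inl by (auto simp: D_def)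
      have sub: "\<Union>C \<subseteq> verts G" using CE simple by (auto simp: simple_graph_def)
      have meet: "e \<inter> \<Union>C \<noteq> {}" if e: "e \<in> C" for e
      proof -
        have "card e = 2" using e CE simple by (auto simp: simple_graph_def)
        then have "e \<noteq> {}" by auto
        then show ?thesis using e by blast
      qed
      have "(\<Sum>j\<in>N i. x j) \<le> real (card (\<Union>C)) * (1 / 48) + real (card (\<Union>C)) * (p / 96)"
        unfolding N_sum Di by (intro add_mono cyc_sum con_sum sub CE meet)
      also have "\<dots> = real (card (\<Union>C)) * (1 / 48 + p / 96)" by (simp add: algebra_simps)
      \<comment> \<open>The dependent events thus cost at most a factor
        \<open>exp (- 1 / 20)\<close> per edge, while the weight \<open>(2 * p) ^ card C\<close>
        exceeds the probability \<open>p ^ card C\<close> by a factor 2 per edge.\<close>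
      also have "\<dots> \<le> real (card C) * (1 / 40)"
        using C(3)[OF CC] p by (intro mult_mono) auto
      finally have "exp (- (1 / 20)) ^ card C \<le> exp (- 2 * (\<Sum>j\<in>N i. x j))"
        by (simp add: exp_of_nat_mult[symmetric])
      moreover have "(1 / 2) ^ card C \<le> exp (- (1 / 20 :: real)) ^ card C"
        using exp_ge_add_one_self[of "- (1 / 20) :: real"] by (intro power_mono) auto
      ultimately have "(2 * p) ^ card C * (1 / 2) ^ card C
          \<le> (2 * p) ^ card C * exp (- 2 * (\<Sum>j\<in>N i. x j))"
        using p by (intro mult_left_mono) auto
      moreover have "(2 * p) ^ card C * (1 / 2) ^ card C = p ^ card C"
        by (subst power_mult_distrib[symmetric]) simp
      ultimately have "p ^ card C \<le> (2 * p) ^ card C * exp (- 2 * (\<Sum>j\<in>N i. x j))"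
        by linarith
      moreover have "measure_pmf.prob P (A i) = p ^ card C"
        unfolding P_def A_def Inl using p by (simp add: prob_bernoulli_all[OF E CE])
      ultimately show ?thesis using Inl by (simp add: x_def)
    next
      case (Inr T)
      with i have TC: "T \<in> Con" by (auto simp: I_def)
      define B where "B = edge_boundary G T"
      have BE: "B \<subseteq> edges G" and Di: "D i = B" using Inr by (auto simp: D_def B_def edge_boundary_def)
      have meet: "e \<inter> T \<noteq> {}" if "e \<in> B" for e
        using that by (auto simp: B_def edge_boundary_def)
      \<comment> \<open>Cycles meeting the boundary are counted through the vertices of \<open>T\<close>, not through the
        boundary edges: the latter would cost a constant times \<open>card B\<close>, more than the exponent
        \<open>p * card B\<close> of the Chernoff bound allows.\<close>
      have "(\<Sum>j\<in>N i. x j) \<le> real (card T) * (1 / 48) + real (card (\<Union>B)) * (p / 96)"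
        unfolding N_sum Di by (intro add_mono cyc_sum con_sum T(1)[OF TC] BE meet)
      also have "\<dots> \<le> real (card T) * (1 / 48) + (2 * real (card B)) * (p / 96)"
        using card_Union_edges_le[OF simple BE finite_subset[OF BE E]] p
        by (intro add_left_mono mult_right_mono) auto
      finally have N: "(\<Sum>j\<in>N i. x j) \<le> real (card T) / 48 + p * real (card B) / 48"
        by (simp add: algebra_simps)
      \<comment> \<open>Put \<open>t = card T\<close> and \<open>b = p * card B\<close>. By
        \<open>8 * L * t \<le> b\<close> and \<open>L \<ge> 2\<close>, the terms
        \<open>2 * L * t\<close>, \<open>t / 24\<close> and \<open>b / 24\<close> are at most
        \<open>b / 4\<close>, \<open>b / 384\<close> and \<open>b / 24\<close>, and these add up to
        less than \<open>7 / 20 * b\<close>.\<close>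
      have "2 * real (card T) \<le> L * real (card T)" using L by (intro mult_right_mono) auto
      then have "- (7 / 20) * (p * real (card B))
          \<le> - 2 * (L * real (card T)) + - 2 * (\<Sum>j\<in>N i. x j)"
        using N T(3)[OF TC] unfolding B_def by linarith
      then have "exp (- (7 / 20) * p * real (card B)) \<le> x i * exp (- 2 * (\<Sum>j\<in>N i. x j))"
        unfolding x_def Inr by (simp add: exp_add[symmetric] mult.assoc)
      moreover have "measure_pmf.prob P (A i) \<le> exp (- (7 / 20) * p * real (card B))"
        unfolding P_def A_def Inr B_def[symmetric] sum.case
        using p by (intro prob_bernoulli_few E BE) auto
      ultimately show ?thesis by linarith
    qed
  qed auto
  then have "space (measure_pmf P) - (\<Union>i\<in>I. A i) \<noteq> {}"
    by (metis less_irrefl measure_empty)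
  then obtain f where f: "\<And>i. i \<in> I \<Longrightarrow> f \<notin> A i" by blast
  show ?thesis
  proof (intro exI[of _ "{e \<in> edges G. f e}"] conjI allI impI ballI)
    fix k C assume "k < g" "C \<in> cycles G k"
    then have "Inl C \<in> I" by (auto simp: I_def Cyc_def)
    then show "\<not> C \<subseteq> {e \<in> edges G. f e}" using f[of "Inl C"] by (auto simp: A_def)
  next
    fix T assume "T \<subseteq> verts G" "linked G T \<and> real (card T) \<le> real (card (verts G)) / 2"
    then have "Inr T \<in> I" by (auto simp: I_def Con_def)
    moreover have "edge_boundary G T \<inter> {e \<in> edges G. f e} = {e \<in> edge_boundary G T. f e}"
      by (auto simp: edge_boundary_def)
    ultimately show "real \<delta> / (4 * real d) * real (card (edge_boundary G T))
        \<le> real (card (edge_boundary G T \<inter> {e \<in> edges G. f e}))"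
      using f[of "Inr T"] by (simp add: A_def p_def)
  qed auto
qed

text \<open>The boundary bound for linked sets extends to all sets of at most half the vertices,
  since linked subsets of such a set are no larger; taking the infimum turns it into the Cheeger
  bound.\<close>

theorem corollary1p4:
  fixes d g \<delta> :: nat and G :: "'a graph"
  assumes "0 < d" and "0 < g" and "0 < \<delta>"
    and "\<delta> \<le> 4 * d"
    and "finite_graph G" and "regular d G"
    and "\<And>k x. k \<le> g \<Longrightarrow> x \<in> verts G \<Longrightarrow>
           real (card (cycles_through G k x)) \<le> (real d / (8 * real \<delta>)) ^ k"
    and "cheeger G \<ge> ereal (8 * real d * (ln (real d) + 2) / real \<delta>)"
  shows "\<exists>H. spanning_subgraph H G \<and> girth H \<ge> enat g \<and>
             cheeger H \<ge> ereal (real \<delta> / (4 * real d)) * cheeger G"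
proof -
  have simple: "simple_graph G" and V: "finite (verts G)"
    using assms(5) by (auto simp: finite_graph_def)
  define c where "c = real \<delta> / (4 * real d)"
  \<comment> \<open>\<open>c \<le> 1\<close> comes from \<open>\<delta> \<le> 4 * d\<close> and lets
    \<open>G\<close> itself serve when \<open>d < 8 * \<delta>\<close>. A spanning subgraph never
    has a larger Cheeger constant than \<open>G\<close>, so a factor above 1 could not be reached
    when \<open>cheeger G\<close> is finite.\<close>
  have c: "0 \<le> c" "c \<le> 1"
    using assms(1) of_nat_mono[OF assms(4), where 'a = real] by (auto simp: c_def field_simps)
  have "\<exists>F \<subseteq> edges G. (\<forall>k<g. \<forall>C\<in>cycles G k. \<not> C \<subseteq> F) \<and>
    (\<forall>T \<subseteq> verts G. linked G T \<and> real (card T) \<le> real (card (verts G)) / 2 \<longrightarrow>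
      c * real (card (edge_boundary G T)) \<le> real (card (edge_boundary G T \<inter> F)))"
  proof (cases "8 * \<delta> \<le> d")
    case True
    show ?thesis unfolding c_def by (rule sparse_expander_exists[OF assms(3) True assms(5-8)])
  next
    case False
    have "cycles G k = {}" if "k < g" for k
    proof (rule equals0I)
      fix C assume CC: "C \<in> cycles G k"
      note facts = cycles_facts[OF CC]
      obtain x where x: "x \<in> \<Union>C" using facts(5) by blast
      then have "x \<in> verts G" using facts(1) simple by (auto simp: simple_graph_def)
      then have "real (card (cycles_through G k x)) \<le> (real d / (8 * real \<delta>)) ^ k"
        using assms(7) that by simp
      \<comment> \<open>The base is below 1, and \<open>3 \<le> k\<close> makes the exponent
        positive; a natural number below 1 is 0.\<close>
      also have "\<dots> < 1"
        using False facts(2) assms(3) by (intro power_less_one_iff[THEN iffD2]) auto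
      finally have "card (cycles_through G k x) = 0" by simp
      moreover have "finite (cycles_through G k x)"
        using finite_cycles[OF assms(5)] by (simp add: cycles_through_def)
      moreover have "C \<in> cycles_through G k x" using CC x by (simp add: cycles_through_def)
      ultimately show False by auto
    qed
    moreover have "edge_boundary G T \<inter> edges G = edge_boundary G T" for T
      by (auto simp: edge_boundary_def)
    ultimately show ?thesis
      using c by (intro exI[of _ "edges G"]) (auto intro: mult_left_le_one_le)
  qed
  then obtain F where F: "F \<subseteq> edges G" "\<forall>k<g. \<forall>C\<in>cycles G k. \<not> C \<subseteq> F"
    and bd: "\<forall>T \<subseteq> verts G. linked G T \<and> real (card T) \<le> real (card (verts G)) / 2 \<longrightarrow>
      c * real (card (edge_boundary G T)) \<le> real (card (edge_boundary G T \<inter> F))"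
    by (elim exE conjE)
  define H where "H = (verts G, F)"
  have "cycles H k = {}" if "k < g" for k
  proof (rule equals0I)
    fix C assume "C \<in> cycles H k"
    then have "C \<subseteq> F" "C \<in> cycles G k" using F(1) by (auto simp: cycles_def H_def)
    then show False using F(2) that by blast
  qed
  then have "girth H \<ge> enat g" by (rule girth_geI)
  moreover have "ereal c * cheeger G \<le> cheeger H"
  proof (rule cheeger_mono_boundary[OF c(1)])
    fix S assume S: "S \<subseteq> verts G" "real (card S) \<le> real (card (verts G)) / 2"
    show "c * real (card (edge_boundary G S)) \<le> real (card (edge_boundary H S))"
    proof (rule boundary_le_if_linked)
      fix T assume T: "T \<subseteq> S" "linked G T"
      have "real (card T) \<le> real (card (verts G)) / 2"
        using card_mono[OF finite_subset[OF S(1) V] T(1)] S(2) by linarith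
      then show "c * real (card (edge_boundary G T)) \<le> real (card (edge_boundary H T))"
        using bd[rule_format, of T] T S(1) edge_boundary_mono_graph[of H G T] F(1)
        by (simp add: H_def)
    qed (use F(1) assms(5) finite_subset[OF S(1) V] in \<open>auto simp: H_def\<close>)
  qed (simp add: H_def)
  ultimately show ?thesis
    using spanning_subgraph_edges[OF simple F(1)] unfolding H_def c_def by blast
qed

end
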